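(* Let $n,p,q$ be positive integers with $n>q$. Let $f:\Gamma^{p,q}_n\to\Omega^{p,q}_n$ send a state $\mu$ of $\mathrm{DASEP}(n,p,q)$ to $(w,\lambda)$, where $w\in S_n(1^q0^{n-q})$ has $w_i=1$ iff $\mu_i\neq0$, and $\lambda$ is the partition obtained by sorting the entries of $\mu$ in weakly decreasing order (so $\mu\in S_n^w(\lambda)$). Then $f$ is a lumping of $\mathrm{DASEP}(n,p,q)$ onto the colored Boolean process on $\Omega^{p,q}_n$: for all $y_0,y_1\in\Omega^{p,q}_n$ and every $\mu_0$ with $f(\mu_0)=y_0$, $$\sum_{\mu:\,f(\mu)=y_1}P(\mu_0,\mu)=Q(y_0,y_1),$$ where $P$ and $Q$ are the transition matrices of the DASEP and of the colored Boolean process respectively.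
   Context: Partitions are written as $n$-tuples $(\lambda_1\ge\cdots\ge\lambda_n\ge0)$; $m_i$ denotes the number of parts equal to $i$, $\ell(\lambda)$ the number of positive parts. $S_n(\lambda)$ is the set of rearrangements of $\lambda$; binary words are elements of $S_n(1^q0^{n-q})$; $S_n^w(\lambda)=\{\mu\in S_n(\lambda):\mu_i\ne0\iff w_i\ne0\}$. $\mathrm{DASEP}(n,p,q)$ with parameters $t,u\in[0,1]$: state space $\Gamma^{p,q}_n$ = all $n$-tuples with entries in $\{0,\dots,p\}$ with exactly $q$ nonzero entries; positions cyclic (position $n$ followed by $1$). Transitions $P(\mu,\nu)$: swapping entries $a=\mu_k\ne b=\mu_{k+1}$ at cyclically consecutive positions has probability $\frac{1}{3n}$ if $b>a$ and $\frac{t}{3n}$ if $a>b$; changing one entry $i$ ($1\le i\le p-1$) to $i+1$ has probability $\frac{u}{3n}$; changing one entry $i+1$ ($i\ge1$) to $i$ has probability $\frac{1}{3n}$; other off-diagonal probabilities $0$, diagonal entries make rows sum to $1$. Colored Boolean process on $\Omega^{p,q}_n=\{(w,\lambda): w\in S_n(1^q0^{n-q}),\ \lambda_1\le p,\ \ell(\lambda)=q\}$ with transition matrix $Q$: $Q((w,\lambda),(w,\lambda'))=\frac{m_i u}{3n}$ if $\lambda$ has $m_i\ge1$ parts equal to $i$ and $\lambda'$ is obtained by changing one part equal to $i$ to $i+1$; $Q((w,\lambda),(w,\lambda'))=\frac{m_i}{3n}$ if $\lambda'$ is obtained by changing one part equal to $i$ to $i-1$; $Q((w,\lambda),(w',\lambda))=\frac{1}{3n}$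 if $w'$ is obtained from $w$ by replacing one occurrence of $01$ at cyclically consecutive positions by $10$; $Q((w,\lambda),(w',\lambda))=\frac{t}{3n}$ if $w'$ is obtained by replacing one cyclically consecutive $10$ by $01$; all other off-diagonal entries $0$, diagonal entries make rows sum to $1$ (all resulting states are required to lie in $\Omega^{p,q}_n$). *)

theory Defs
  imports Complex_Main "HOL-Combinatorics.Multiset_Permutations"
begin

text \<open>
  An \<open>n\<close>-tuple is a list of length \<open>n\<close>, with positions \<open>0, \<dots>, n - 1\<close>; the cyclic successor of
  position \<open>k\<close> is \<open>Suc k mod n\<close>. A partition is a weakly decreasing \<open>n\<close>-tuple, padded with zeros.
\<close>

definition S :: "nat list \<Rightarrow> nat list set" where
  "S lam = permutations_of_multiset (mset lam)"

definition binary_words :: "nat \<Rightarrow> nat \<Rightarrow> nat list set" where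
  "binary_words n q = S (replicate q 1 @ replicate (n - q) 0)"

definition S_word :: "nat list \<Rightarrow> nat list \<Rightarrow> nat list set" where
  "S_word w lam = {mu \<in> S lam. \<forall>i<length lam. mu ! i \<noteq> 0 \<longleftrightarrow> w ! i \<noteq> 0}"

definition num_nonzero :: "nat list \<Rightarrow> nat" where
  "num_nonzero xs = length (filter (\<lambda>x. x \<noteq> 0) xs)"

definition swap_next :: "nat \<Rightarrow> nat list \<Rightarrow> nat list" where
  "swap_next k xs = (let k' = Suc k mod length xs in xs[k := xs ! k', k' := xs ! k])"

text \<open>
  The transition matrix with given off-diagonal entries whose rows, over the state space \<open>X\<close>,
  sum to \<open>1\<close>.
\<close>

definition complete_diagonal :: "'s set \<Rightarrow> ('s \<Rightarrow> 's \<Rightarrow> real) \<Rightarrow> 's \<Rightarrow> 's \<Rightarrow> real" where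
  "complete_diagonal X R x y = (if x = y then 1 - (\<Sum>z\<in>X - {x}. R x z) else R x y)"

definition Gamma :: "nat \<Rightarrow> nat \<Rightarrow> nat \<Rightarrow> nat list set" where
  "Gamma n p q = {mu. length mu = n \<and> set mu \<subseteq> {0..p} \<and> num_nonzero mu = q}"

text \<open>
  The probabilities of all elementary moves from \<open>mu\<close> to \<open>nu\<close> are added. Distinct moves lead to
  distinct states, except that for \<open>n = 2\<close> the pairs of positions \<open>(1,2)\<close> and \<open>(2,1)\<close> are both
  cyclically consecutive and exchanging either one gives the same state.
\<close>

definition dasep_rate ::
  "nat \<Rightarrow> nat \<Rightarrow> real \<Rightarrow> real \<Rightarrow> nat list \<Rightarrow> nat list \<Rightarrow> real" where
  "dasep_rate n p t u mu nu =
     (\<Sum>k | k < n \<and> mu ! k < mu ! (Suc k mod n) \<and> nu = swap_next k mu. 1 / (3 * real n))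
   + (\<Sum>k | k < n \<and> mu ! k > mu ! (Suc k mod n) \<and> nu = swap_next k mu. t / (3 * real n))
   + (\<Sum>k | k < n \<and> mu ! k \<in> {1..<p} \<and> nu = mu[k := mu ! k + 1]. u / (3 * real n))
   + (\<Sum>k | k < n \<and> mu ! k \<ge> 2 \<and> nu = mu[k := mu ! k - 1]. 1 / (3 * real n))"

definition dasep_P ::
  "nat \<Rightarrow> nat \<Rightarrow> nat \<Rightarrow> real \<Rightarrow> real \<Rightarrow> nat list \<Rightarrow> nat list \<Rightarrow> real" where
  "dasep_P n p q t u = complete_diagonal (Gamma n p q) (dasep_rate n p t u)"

definition Omega :: "nat \<Rightarrow> nat \<Rightarrow> nat \<Rightarrow> (nat list \<times> nat list) set" where
  "Omega n p q = {(w, lam). w \<in> binary_words n q \<and>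
     length lam = n \<and> sorted_wrt (\<ge>) lam \<and> set lam \<subseteq> {0..p} \<and> num_nonzero lam = q}"

definition change_part :: "nat \<Rightarrow> nat \<Rightarrow> nat list \<Rightarrow> nat list \<Rightarrow> bool" where
  "change_part i j lam lam' \<longleftrightarrow>
     i \<in> set lam \<and> mset lam' = add_mset j (mset lam - {#i#})"

text \<open>
  As before, the probabilities of all elementary moves are added; \<open>count_list lam i\<close> is the
  multiplicity of \<open>i\<close> in \<open>lam\<close>. The ranges of \<open>i\<close> are those for which the new part lies in
  \<open>{1..p}\<close>, that is, for which the move stays inside \<^term>\<open>Omega n p q\<close>.
\<close>

fun boolean_rate ::
  "nat \<Rightarrow> nat \<Rightarrow> real \<Rightarrow> real \<Rightarrow> nat list \<times> nat list \<Rightarrow> nat list \<times> nat list \<Rightarrow> real" where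
  "boolean_rate n p t u (w, lam) (w', lam') =
     (if w' = w then
        (\<Sum>i | i \<in> {1..<p} \<and> change_part i (i + 1) lam lam'.
            real (count_list lam i) * u / (3 * real n))
      + (\<Sum>i | i \<in> {2..p} \<and> change_part i (i - 1) lam lam'.
            real (count_list lam i) / (3 * real n))
      else 0)
   + (if lam' = lam then
        (\<Sum>k | k < n \<and> w ! k = 0 \<and> w ! (Suc k mod n) = 1 \<and> w' = swap_next k w.
            1 / (3 * real n))
      + (\<Sum>k | k < n \<and> w ! k = 1 \<and> w ! (Suc k mod n) = 0 \<and> w' = swap_next k w.
            t / (3 * real n))
      else 0)"

definition boolean_Q ::
  "nat \<Rightarrow> nat \<Rightarrow> nat \<Rightarrow> real \<Rightarrow> real \<Rightarrow> nat list \<times> nat list \<Rightarrow> nat list \<times> nat list \<Rightarrow> real" where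
  "boolean_Q n p q t u = complete_diagonal (Omega n p q) (boolean_rate n p t u)"

definition lumping_map :: "nat list \<Rightarrow> nat list \<times> nat list" where
  "lumping_map mu = (map (\<lambda>a. if a \<noteq> 0 then 1 else 0) mu, rev (sort mu))"

lemma lumping_map_S_word:
  assumes "lumping_map mu = (w, lam)"
  shows "mu \<in> S_word w lam"
  using assms
  by (auto simp: lumping_map_def S_word_def S_def permutations_of_multiset_def split: if_splits)

definition is_lumping ::
  "'x set \<Rightarrow> ('x \<Rightarrow> 'x \<Rightarrow> real) \<Rightarrow> 'y set \<Rightarrow> ('y \<Rightarrow> 'y \<Rightarrow> real) \<Rightarrow> ('x \<Rightarrow> 'y) \<Rightarrow> bool" where
  "is_lumping X P Y Q f \<longleftrightarrow> f ` X = Y \<and>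
     (\<forall>y0\<in>Y. \<forall>y1\<in>Y. \<forall>x0\<in>X. f x0 = y0 \<longrightarrow> (\<Sum>x | x \<in> X \<and> f x = y1. P x0 x) = Q y0 y1)"

end

theory Submission
  imports Defs
begin

text \<open>
  It suffices to compare off-diagonal rates, since the diagonals are fixed by the row sums. A move
  of the DASEP changes at most one of the word and the partition: exchanging two entries keeps the
  partition and acts on the word by the corresponding exchange, while raising or lowering a nonzero
  entry keeps the word and changes one part. A given change of a part of size \<open>i\<close> arises from each
  of the \<open>m\<^sub>i\<close> positions carrying \<open>i\<close>, which produces the factor \<open>m\<^sub>i\<close> in the colored Boolean process.
\<close>

section \<open>Reduction to the off-diagonal rates\<close>

lemma is_lumping_complete_diagonal:
  assumes fin: "finite X" and onto: "f ` X = Y"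
    and rates: "\<And>x0 y1. x0 \<in> X \<Longrightarrow> y1 \<in> Y \<Longrightarrow> y1 \<noteq> f x0 \<Longrightarrow>
      (\<Sum>x | x \<in> X \<and> f x = y1. R x0 x) = R' (f x0) y1"
  shows "is_lumping X (complete_diagonal X R) Y (complete_diagonal Y R') f"
  unfolding is_lumping_def
proof (intro conjI onto ballI impI)
  fix y0 y1 x0
  assume y1: "y1 \<in> Y" and x0: "x0 \<in> X" and y0: "f x0 = y0"
  show "(\<Sum>x | x \<in> X \<and> f x = y1. complete_diagonal X R x0 x) = complete_diagonal Y R' y0 y1"
  proof (cases "y1 = y0")
    case False
    have "(\<Sum>x | x \<in> X \<and> f x = y1. complete_diagonal X R x0 x) = (\<Sum>x | x \<in> X \<and> f x = y1. R x0 x)"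
      using False y0 by (intro sum.cong) (auto simp: complete_diagonal_def)
    also have "\<dots> = R' y0 y1"
      using rates[OF x0 y1] False y0 by simp
    finally show ?thesis
      using False by (simp add: complete_diagonal_def)
  next
    case True
    let ?F = "{x \<in> X. f x = y0}"
    have F: "finite ?F" "x0 \<in> ?F"
      using fin x0 y0 by auto
    \<comment> \<open>The total rate out of \<open>y0\<close> is the total rate from
      \<open>x0\<close> out of its fibre: the states outside \<open>?F\<close> are grouped by their
      image, which is never \<open>y0\<close>.\<close>
    have "(\<Sum>z\<in>Y - {y0}. R' y0 z) = (\<Sum>z\<in>Y - {y0}. \<Sum>x | x \<in> X \<and> f x = z. R x0 x)"
      using rates x0 y0 by (intro sum.cong) auto
    also have "\<dots> = (\<Sum>z\<in>Y - {y0}. \<Sum>x | x \<in> X - ?F \<and> f x = z. R x0 x)"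
      by (intro sum.cong) auto
    also have "\<dots> = (\<Sum>x\<in>X - ?F. R x0 x)"
      using fin onto by (intro sum.group) auto
    finally have out: "(\<Sum>z\<in>Y - {y0}. R' y0 z) = (\<Sum>x\<in>X - ?F. R x0 x)" .
    have split: "X - {x0} = (?F - {x0}) \<union> (X - ?F)"
      using F by auto
    have "(\<Sum>x\<in>X - {x0}. R x0 x) = (\<Sum>x\<in>?F - {x0}. R x0 x) + (\<Sum>x\<in>X - ?F. R x0 x)"
      unfolding split by (rule sum.union_disjoint) (use fin in auto)
    \<comment> \<open>The diagonal entry subtracts every rate out of \<open>x0\<close>. The rates
      that stay inside the fibre are added back by the other summands, so only the rates leaving the
      fibre remain.\<close>
    moreover have "(\<Sum>x\<in>?F. complete_diagonal X R x0 x)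
        = 1 - (\<Sum>x\<in>X - {x0}. R x0 x) + (\<Sum>x\<in>?F - {x0}. R x0 x)"
      by (subst sum.remove[OF F]) (auto simp: complete_diagonal_def intro!: sum.cong split: if_splits)
    ultimately show ?thesis
      using True out by (simp add: complete_diagonal_def)
  qed
qed

section \<open>Words, sorted partitions and elementary moves\<close>

abbreviation word :: "nat list \<Rightarrow> nat list" where
  "word \<equiv> map (\<lambda>a. if a \<noteq> 0 then 1 else 0)"

text \<open>A multiset has only one weakly decreasing arrangement, so the partition component of
  \<open>lumping_map\<close> can be compared through multisets alone.\<close>

lemma rev_sort_eq_iff:
  fixes xs ys :: "'a::linorder list"
  assumes "sorted_wrt (\<ge>) ys"
  shows "rev (sort xs) = ys \<longleftrightarrow> mset xs = mset ys"
proof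
  assume "mset xs = mset ys"
  moreover have "sorted (rev ys)"
    using assms by (simp add: sorted_wrt_rev)
  ultimately have "sort xs = rev ys"
    by (intro properties_for_sort) auto
  then show "rev (sort xs) = ys"
    by simp
qed auto

text \<open>All words of tuples of the same length with the same number of nonzero entries are
  rearrangements of each other. This places them in \<open>binary_words\<close>, and it also yields
  the permutation behind surjectivity.\<close>

lemma mset_word:
  "mset (word xs) = replicate_mset (num_nonzero xs) 1 + replicate_mset (length xs - num_nonzero xs) 0"
proof (induction xs)
  case (Cons x xs)
  have "num_nonzero xs \<le> length xs"
    by (simp add: num_nonzero_def)
  with Cons show ?case
    by (auto simp: num_nonzero_def Suc_diff_le)
qed (simp add: num_nonzero_def)

lemma num_nonzero_mset_cong: "mset xs = mset ys \<Longrightarrow> num_nonzero xs = num_nonzero ys"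
  unfolding num_nonzero_def by (metis mset_filter size_mset)

lemma num_nonzero_list_update:
  assumes "k < length xs" "xs ! k \<noteq> 0" "a \<noteq> 0"
  shows "num_nonzero (xs[k := a]) = num_nonzero xs"
  using assms unfolding num_nonzero_def
  by (induction xs arbitrary: k) (auto simp: nth_Cons split: nat.splits)

lemma word_list_update:
  assumes "xs ! k \<noteq> 0" "a \<noteq> 0"
  shows "word (xs[k := a]) = word xs"
  by (cases "k < length xs") (use assms in \<open>auto simp: nth_list_update intro!: nth_equalityI simp del: map_update\<close>)

lemma Suc_mod_less: "k < n \<Longrightarrow> Suc k mod n < n"
  by (rule mod_less_divisor) linarith

lemma mset_swap_next: "k < length xs \<Longrightarrow> mset (swap_next k xs) = mset xs"
  unfolding swap_next_def Let_def by (rule mset_swap) (simp_all only: Suc_mod_less)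

lemma map_swap_next:
  assumes "k < length xs"
  shows "map f (swap_next k xs) = swap_next k (map f xs)"
  using assms Suc_mod_less[of k "length xs"] by (simp add: swap_next_def Let_def map_update)

lemma swap_next_eq_self:
  assumes "xs ! k = xs ! (Suc k mod length xs)"
  shows "swap_next k xs = xs"
proof -
  have "xs[k := xs ! (Suc k mod length xs)] = xs" "xs[Suc k mod length xs := xs ! k] = xs"
    using assms list_update_id by metis+
  then show ?thesis
    by (simp only: swap_next_def Let_def)
qed

section \<open>The state space and its image\<close>

lemma finite_Gamma: "finite (Gamma n p q)"
  by (rule finite_subset[OF _ finite_lists_length_eq[of "{0..p}" n]]) (auto simp: Gamma_def)

text \<open>Length, range of the entries and number of nonzero entries are invariant under
  rearrangement, so membership passes between a tuple, its swaps and its sorted form.\<close>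

lemma Gamma_cong_mset: "mset xs = mset ys \<Longrightarrow> xs \<in> Gamma n p q \<longleftrightarrow> ys \<in> Gamma n p q"
  using num_nonzero_mset_cong[of xs ys] mset_eq_setD[of xs ys] mset_eq_length[of xs ys]
  by (auto simp: Gamma_def)

lemma list_update_in_Gamma:
  assumes "mu \<in> Gamma n p q" "k < n" "mu ! k \<noteq> 0" "a \<in> {1..p}"
  shows "mu[k := a] \<in> Gamma n p q"
  using assms set_update_subset_insert[of mu k a]
  by (auto simp: Gamma_def num_nonzero_list_update)

lemma lumping_map_image_Gamma: "lumping_map ` Gamma n p q = Omega n p q"
proof (intro equalityI subsetI)
  fix y assume "y \<in> lumping_map ` Gamma n p q"
  then obtain mu where mu: "mu \<in> Gamma n p q" and y: "y = (word mu, rev (sort mu))"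
    by (auto simp: lumping_map_def)
  have "rev (sort mu) \<in> Gamma n p q"
    using mu by (subst Gamma_cong_mset[of _ mu]) auto
  moreover have "word mu \<in> binary_words n q"
    using mu mset_word[of mu]
    by (auto simp: binary_words_def S_def permutations_of_multiset_def Gamma_def)
  moreover have "sorted_wrt (\<ge>) (rev (sort mu))"
    by (simp add: sorted_wrt_rev)
  ultimately show "y \<in> Omega n p q"
    by (auto simp: y Omega_def Gamma_def)
next
  fix y assume "y \<in> Omega n p q"
  then obtain w lam where y: "y = (w, lam)" and w: "w \<in> binary_words n q"
    and lam: "lam \<in> Gamma n p q" and sorted: "sorted_wrt (\<ge>) lam"
    by (auto simp: Omega_def Gamma_def)
  have "mset w = mset (word lam)"
    using w lam mset_word[of lam]
    by (auto simp: binary_words_def S_def permutations_of_multiset_def Gamma_def)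
  \<comment> \<open>A permutation taking the word of \<open>lam\<close> to \<open>w\<close>, applied
    to \<open>lam\<close> itself, puts the positive parts exactly where \<open>w\<close> has a 1;
    this gives the preimage of \<open>y\<close>.\<close>
  then obtain \<pi> where \<pi>: "\<pi> permutes {..<length (word lam)}" "permute_list \<pi> (word lam) = w"
    by (rule mset_eq_permutation)
  let ?mu = "permute_list \<pi> lam"
  have mset: "mset ?mu = mset lam"
    using \<pi> by simp
  have "word ?mu = w"
    using \<pi> by (simp add: permute_list_map)
  then have "lumping_map ?mu = y"
    using mset sorted by (simp add: lumping_map_def y rev_sort_eq_iff)
  moreover have "?mu \<in> Gamma n p q"
    using lam Gamma_cong_mset[OF mset] by simp
  ultimately show "y \<in> lumping_map ` Gamma n p q"
    by blast
qed

section \<open>Lumping of swaps and of part changes\<close>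

lemma sum_over_targets:
  fixes g :: "nat \<Rightarrow> 'a" and c :: real
  assumes "finite X"
    and "\<And>k. k < n \<Longrightarrow> C k \<Longrightarrow> g k \<in> X"
  shows "(\<Sum>x | x \<in> X \<and> f x = y. \<Sum>k | k < n \<and> C k \<and> x = g k. c)
    = (\<Sum>k | k < n \<and> C k \<and> f (g k) = y. c)"
proof -
  \<comment> \<open>Each admissible index has exactly one target \<open>g k\<close>, so summing over
    the fibre of \<open>y\<close> only sorts the indices by target. Indices sharing a target are
    counted separately on both sides.\<close>
  have "(\<Sum>k | k < n \<and> C k \<and> f (g k) = y. c)
      = (\<Sum>x | x \<in> X \<and> f x = y. \<Sum>k | k \<in> {k. k < n \<and> C k \<and> f (g k) = y} \<and> g k = x. c)"
    by (rule sum.group[symmetric]) (use assms in auto)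
  also have "\<dots> = (\<Sum>x | x \<in> X \<and> f x = y. \<Sum>k | k < n \<and> C k \<and> x = g k. c)"
    by (rule sum.cong[OF refl], rule sum.cong) auto
  finally show ?thesis
    by (rule sym)
qed

lemma lumping_map_swap_next:
  assumes "k < length mu"
  shows "lumping_map (swap_next k mu) = (swap_next k (word mu), rev (sort mu))"
proof -
  have "sort (swap_next k mu) = sort mu"
    using mset_swap_next[OF assms] by (intro properties_for_sort) auto
  with map_swap_next[OF assms] show ?thesis
    by (simp add: lumping_map_def)
qed

text \<open>Exchanging two zeros or two nonzero entries fixes both word and partition, which
  \<open>neq\<close> rules out. In the remaining exchanges exactly one entry is zero, and there the
  order condition \<open>C\<close> can be read off the word.\<close>

lemma sum_swaps_lumped:
  assumes neq: "(w', lam') \<noteq> lumping_map mu"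
    and len: "length mu = n"
    and C: "\<And>a b. (a = 0) \<noteq> (b = 0) \<Longrightarrow>
      C (if a \<noteq> 0 then 1 else 0) (if b \<noteq> 0 then 1 else 0) \<longleftrightarrow> C a b"
  shows "(\<Sum>k | k < n \<and> C (mu ! k) (mu ! (Suc k mod n)) \<and>
        lumping_map (swap_next k mu) = (w', lam'). c)
    = (if lam' = rev (sort mu) then
        (\<Sum>k | k < n \<and> C (word mu ! k) (word mu ! (Suc k mod n)) \<and> w' = swap_next k (word mu).
          c :: real)
      else 0)"
proof (cases "lam' = rev (sort mu)")
  case True
  then have w': "w' \<noteq> word mu"
    using neq by (simp add: lumping_map_def)
  have "k < n \<and> C (mu ! k) (mu ! (Suc k mod n)) \<and> lumping_map (swap_next k mu) = (w', lam')
      \<longleftrightarrow> k < n \<and> C (word mu ! k) (word mu ! (Suc k mod n)) \<and> w' = swap_next k (word mu)" for k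
  proof (cases "k < n \<and> w' = swap_next k (word mu)")
    case k: True
    then have nth: "word mu ! k = (if mu ! k \<noteq> 0 then 1 else 0)"
      "word mu ! (Suc k mod n) = (if mu ! (Suc k mod n) \<noteq> 0 then 1 else 0)"
      using len Suc_mod_less[of k n] by simp_all
    \<comment> \<open>Equal letters would make the exchange fix the word, contradicting
      \<open>w'\<close>.\<close>
    have "word mu ! k \<noteq> word mu ! (Suc k mod n)"
      using k w' len swap_next_eq_self[of "word mu" k] by (metis length_map)
    then have "(mu ! k = 0) \<noteq> (mu ! (Suc k mod n) = 0)"
      unfolding nth by (auto split: if_splits)
    then have "C (word mu ! k) (word mu ! (Suc k mod n)) \<longleftrightarrow> C (mu ! k) (mu ! (Suc k mod n))"
      unfolding nth by (rule C)
    moreover have "lumping_map (swap_next k mu) = (w', lam')"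
      using k len True lumping_map_swap_next[of k mu] by simp
    ultimately show ?thesis
      using k by blast
  qed (use len lumping_map_swap_next in auto)
  with True show ?thesis
    by simp
next
  case False
  then have "{k. k < n \<and> C (mu ! k) (mu ! (Suc k mod n)) \<and>
      lumping_map (swap_next k mu) = (w', lam')} = {}"
    using len lumping_map_swap_next by auto
  with False show ?thesis
    by (simp del: Collect_empty_eq)
qed

text \<open>Grouping the positions by the entry \<open>i\<close> they carry turns the sum over
  positions into a sum over parts, each weighted by the multiplicity of \<open>i\<close>. The map
  \<open>d\<close> stands for raising or for lowering a part.\<close>

lemma sum_part_changes_lumped:
  fixes d :: "nat \<Rightarrow> nat" and c :: real
  assumes len: "length mu = n" and sorted: "sorted_wrt (\<ge>) lam'"
    and fin: "finite I" and I: "\<And>i. i \<in> I \<Longrightarrow> i \<noteq> 0 \<and> d i \<noteq> 0"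
  shows "(\<Sum>k | k < n \<and> mu ! k \<in> I \<and> lumping_map (mu[k := d (mu ! k)]) = (w', lam'). c)
    = (if w' = word mu then
        (\<Sum>i | i \<in> I \<and> change_part i (d i) (rev (sort mu)) lam'.
          real (count_list (rev (sort mu)) i) * c)
      else 0)"
proof -
  let ?J = "{i. i \<in> I \<and> change_part i (d i) (rev (sort mu)) lam'}"
  let ?K = "{k. k < n \<and> mu ! k \<in> I \<and> lumping_map (mu[k := d (mu ! k)]) = (w', lam')}"
  \<comment> \<open>The word is kept because \<open>d\<close> produces no zeros on \<open>I\<close>.
    The right-hand side depends on \<open>k\<close> only through \<open>mu ! k\<close>, so of the
    positions carrying a given \<open>i\<close> in \<open>I\<close> either all reach the target or
    none does.\<close>
  have lump: "lumping_map (mu[k := d (mu ! k)]) = (w', lam')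
      \<longleftrightarrow> w' = word mu \<and> change_part (mu ! k) (d (mu ! k)) (rev (sort mu)) lam'"
    if "k < n" "mu ! k \<in> I" for k
    using that len sorted I[of "mu ! k"] word_list_update[of mu k "d (mu ! k)"]
    by (auto simp: lumping_map_def rev_sort_eq_iff change_part_def mset_update)
  show ?thesis
  proof (cases "w' = word mu")
    case True
    have "(\<Sum>k\<in>?K. c) = (\<Sum>i\<in>?J. \<Sum>k | k \<in> ?K \<and> mu ! k = i. c)"
      by (rule sum.group[symmetric]) (use lump fin True in auto)
    also have "\<dots> = (\<Sum>i\<in>?J. real (count_list (rev (sort mu)) i) * c)"
    proof (rule sum.cong)
      fix i assume "i \<in> ?J"
      then have "{k \<in> ?K. mu ! k = i} = {k. k < length mu \<and> i = mu ! k}"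
        using lump True len by auto
      moreover have "count_list (rev (sort mu)) i = card {k. k < length mu \<and> i = mu ! k}"
        by (metis count_list_eq_length_filter count_mset length_filter_conv_card mset_rev mset_sort)
      ultimately show "(\<Sum>k | k \<in> ?K \<and> mu ! k = i. c) = real (count_list (rev (sort mu)) i) * c"
        by simp
    qed simp
    finally show ?thesis
      using True by simp
  next
    case False
    then have "?K = {}"
      using lump by auto
    with False show ?thesis
      by (simp del: Collect_empty_eq)
  qed
qed

section \<open>Comparison of the rates\<close>

lemma dasep_rate_lumped:
  assumes mu: "mu \<in> Gamma n p q" and y: "y \<in> Omega n p q" and neq: "y \<noteq> lumping_map mu"
  shows "(\<Sum>nu | nu \<in> Gamma n p q \<and> lumping_map nu = y. dasep_rate n p t u mu nu)
    = boolean_rate n p t u (lumping_map mu) y"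
proof -
  obtain w' lam' where y': "y = (w', lam')"
    by fastforce
  let ?lam = "rev (sort mu)"
  have sorted: "sorted_wrt (\<ge>) lam'"
    using y by (simp add: y' Omega_def)
  have len: "length mu = n" and le: "\<And>k. k < n \<Longrightarrow> mu ! k \<le> p"
    using mu nth_mem by (fastforce simp: Gamma_def)+
  have swap: "swap_next k mu \<in> Gamma n p q" if "k < n" for k
    using that mu len mset_swap_next Gamma_cong_mset by blast
  have up: "mu[k := mu ! k + 1] \<in> Gamma n p q" if "k < n" "mu ! k \<in> {1..<p}" for k
    using that mu by (intro list_update_in_Gamma) auto
  have down: "mu[k := mu ! k - 1] \<in> Gamma n p q" if "k < n" "mu ! k \<in> {2..p}" for k
    using that mu by (intro list_update_in_Gamma) auto
  \<comment> \<open>Entries are bounded by \<open>p\<close>, so the lowering moves have the same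
    finite range as in \<open>boolean_rate\<close>.\<close>
  have range: "k < n \<and> mu ! k \<ge> 2 \<and> P \<longleftrightarrow> k < n \<and> mu ! k \<in> {2..p} \<and> P" for k P
    using le by auto
  have le_1: "word mu ! k \<le> 1" if "k < n" for k
    using that len by simp
  \<comment> \<open>Between letters 0 and 1, a strict ascent is exactly the pattern 01 and a strict
    descent exactly 10.\<close>
  have word_01: "k < n \<and> word mu ! k < word mu ! (Suc k mod n) \<and> P \<longleftrightarrow>
      k < n \<and> word mu ! k = 0 \<and> word mu ! (Suc k mod n) = 1 \<and> P"
    "k < n \<and> word mu ! k > word mu ! (Suc k mod n) \<and> P \<longleftrightarrow>
      k < n \<and> word mu ! k = 1 \<and> word mu ! (Suc k mod n) = 0 \<and> P" for k P
    using le_1[of k] le_1[OF Suc_mod_less[of k n]] by linarith+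
  \<comment> \<open>The four kinds of moves are lumped separately; each move stays in
    \<open>Gamma n p q\<close>, so none of its targets is lost from the sum.\<close>
  have "(\<Sum>nu | nu \<in> Gamma n p q \<and> lumping_map nu = y. dasep_rate n p t u mu nu)
    = (\<Sum>k | k < n \<and> mu ! k < mu ! (Suc k mod n) \<and> lumping_map (swap_next k mu) = y.
        1 / (3 * real n))
    + (\<Sum>k | k < n \<and> mu ! k > mu ! (Suc k mod n) \<and> lumping_map (swap_next k mu) = y.
        t / (3 * real n))
    + (\<Sum>k | k < n \<and> mu ! k \<in> {1..<p} \<and> lumping_map (mu[k := mu ! k + 1]) = y.
        u / (3 * real n))
    + (\<Sum>k | k < n \<and> mu ! k \<in> {2..p} \<and> lumping_map (mu[k := mu ! k - 1]) = y.
        1 / (3 * real n))"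
    unfolding dasep_rate_def sum.distrib range
    by (intro arg_cong2[where f = "(+)"] sum_over_targets finite_Gamma) (use swap up down in auto)
  also have "(\<Sum>k | k < n \<and> mu ! k < mu ! (Suc k mod n) \<and> lumping_map (swap_next k mu) = y.
        1 / (3 * real n))
      = (if lam' = ?lam then
          (\<Sum>k | k < n \<and> word mu ! k < word mu ! (Suc k mod n) \<and> w' = swap_next k (word mu).
            1 / (3 * real n))
        else 0)"
    unfolding y' by (rule sum_swaps_lumped[where C = "(<)"])
      (use neq len in \<open>auto simp: y' split: if_splits\<close>)
  also have "(\<Sum>k | k < n \<and> mu ! k > mu ! (Suc k mod n) \<and> lumping_map (swap_next k mu) = y.
        t / (3 * real n))
      = (if lam' = ?lam then
          (\<Sum>k | k < n \<and> word mu ! k > word mu ! (Suc k mod n) \<and> w' = swap_next k (word mu).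
            t / (3 * real n))
        else 0)"
    unfolding y' by (rule sum_swaps_lumped[where C = "\<lambda>a b. b < a"])
      (use neq len in \<open>auto simp: y' split: if_splits\<close>)
  also have "(\<Sum>k | k < n \<and> mu ! k \<in> {1..<p} \<and> lumping_map (mu[k := mu ! k + 1]) = y.
        u / (3 * real n))
      = (if w' = word mu then
          (\<Sum>i | i \<in> {1..<p} \<and> change_part i (i + 1) ?lam lam'.
            real (count_list ?lam i) * (u / (3 * real n)))
        else 0)"
    unfolding y' by (rule sum_part_changes_lumped[where d = "\<lambda>i. i + 1"]) (use len sorted in auto)
  also have "(\<Sum>k | k < n \<and> mu ! k \<in> {2..p} \<and> lumping_map (mu[k := mu ! k - 1]) = y.
        1 / (3 * real n))
      = (if w' = word mu then
          (\<Sum>i | i \<in> {2..p} \<and> change_part i (i - 1) ?lam lam'.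
            real (count_list ?lam i) * (1 / (3 * real n)))
        else 0)"
    unfolding y' by (rule sum_part_changes_lumped[where d = "\<lambda>i. i - 1"]) (use len sorted in auto)
  finally show ?thesis
    \<comment> \<open>Here each sum carries its own condition, whereas \<open>boolean_rate\<close>
      puts the two part changes under one condition and the two exchanges under another; the four
      cases align them.\<close>
    by (cases "w' = word mu"; cases "lam' = ?lam")
      (simp_all only: y' lumping_map_def boolean_rate.simps word_01 times_divide_eq_right
        mult_1_right if_True if_False add_0_left add_0_right add_ac simp_thms)
qed

theorem theorem2p3:
  fixes n p q :: nat and t u :: real
  assumes "n > 0" and "p > 0" and "q > 0" and "n > q"
    and "t \<in> {0..1}" and "u \<in> {0..1}"
  shows "is_lumping (Gamma n p q) (dasep_P n p q t u) (Omega n p q) (boolean_Q n p q t u)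
           lumping_map"
  unfolding dasep_P_def boolean_Q_def
  by (intro is_lumping_complete_diagonal finite_Gamma lumping_map_image_Gamma dasep_rate_lumped)

end
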